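(* Let $a(n)$ be a periodic sequence taking values in a finite set. Then for every non-integer real number $c>1$, the subword complexity $N_H$ of the sequence $(a(\lfloor n^c\rfloor))_{n\ge0}$ is bounded from above by a polynomial in $H$.
   Context: For a sequence $b$ over a finite alphabet, its subword complexity is $N_H(b)=\#\{(b(n),b(n+1),\dots,b(n+H-1)):n\ge0\}$. *)

theory Defs
  imports Complex_Main "HOL-Computational_Algebra.Polynomial"
begin

definition periodic_seq :: "(nat \<Rightarrow> 'a) \<Rightarrow> bool" where
  "periodic_seq a \<longleftrightarrow> (\<exists>q>0. \<forall>n. a (n + q) = a n)"

definition subwords :: "(nat \<Rightarrow> 'a) \<Rightarrow> nat \<Rightarrow> 'a list set" where
  "subwords b H = {map b [n..<n + H] | n. True}"

definition subword_complexity :: "(nat \<Rightarrow> 'a) \<Rightarrow> nat \<Rightarrow> nat" where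
  "subword_complexity b H = card (subwords b H)"

text \<open>Over a finite alphabet the cardinality above is a genuine count: it never takes the
  default value 0 that \<^const>\<open>card\<close> has on infinite sets.\<close>

lemma finite_subwords:
  assumes "finite (range b)"
  shows "finite (subwords b H)"
proof (rule finite_subset)
  show "subwords b H \<subseteq> {xs. set xs \<subseteq> range b \<and> length xs = H}"
    by (auto simp: subwords_def)
  show "finite {xs. set xs \<subseteq> range b \<and> length xs = H}"
    using assms by (rule finite_lists_length_eq)
qed

end

theory Submission
  imports Defs
begin

text \<open>
  Let \<open>\<Delta>\<close> be the forward difference operator, \<open>q\<close> a period of \<open>a\<close>, and \<open>m \<ge> c\<close> an integer. The
  sequence \<open>f n = (n + 1) powr c\<close> has a bounded and monotone \<open>m\<close>-th difference. Hence each shift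
  \<open>h \<mapsto> f (n + h)\<close> differs by integer multiples of \<open>q\<close> from a function \<open>g n\<close> with the same \<open>m\<close>-th
  difference and \<open>\<bar>g n h\<bar> \<le> C (1 + h) ^ m\<close>. The word at \<open>n\<close> is determined by the set of
  integer points \<open>(h, j)\<close>, \<open>h < H\<close>, \<open>\<bar>j\<bar> \<le> C (1 + H) ^ m\<close>, below the graph of \<open>g n\<close>.

  These sets shatter no \<open>2 (m + 1)\<close> points: otherwise there are \<open>n\<close> and \<open>n'\<close> such that \<open>g n - g n'\<close>
  alternates in sign on the left \<open>m + 1\<close> points, starting with \<open>+\<close>, and on the right \<open>m + 1\<close>
  points, starting with \<open>-\<close>. By a discrete form of Rolle's theorem \<open>\<Delta>^m (g n - g n')\<close> then takes
  both signs, although \<open>\<Delta>^m f (n + h) - \<Delta>^m f (n' + h)\<close> has a constant sign by monotonicity. The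
  Sauer-Shelah lemma gives a polynomial bound for the number of sets.
\<close>

section \<open>Forward differences\<close>

text \<open>The argument type is generic because the operator acts both on functions of a real
  variable, where the mean value theorem applies, and on sequences over \<open>nat\<close>.\<close>

definition fwd_diff :: "('a::semiring_1 \<Rightarrow> 'b::ab_group_add) \<Rightarrow> 'a \<Rightarrow> 'b" where
  "fwd_diff f x = f (x + 1) - f x"

lemma fwd_diff_pow_Suc: "(fwd_diff ^^ Suc m) f = (fwd_diff ^^ m) (fwd_diff f)"
  by (simp only: funpow_Suc_right comp_apply)

lemma fwd_diff_pow_diff:
  "(fwd_diff ^^ m) (\<lambda>x. f x - g x) x = (fwd_diff ^^ m) f x - (fwd_diff ^^ m) g x"
  by (induction m arbitrary: x) (simp_all add: fwd_diff_def)

lemma fwd_diff_pow_shift: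
  "(fwd_diff ^^ m) (\<lambda>h. f (n + h)) h = (fwd_diff ^^ m) f (n + h)"
  by (induction m arbitrary: h) (simp_all add: fwd_diff_def add.assoc)

lemma fwd_diff_pow_of_nat:
  "(fwd_diff ^^ m) (\<lambda>n::nat. f (of_nat n + 1)) n = (fwd_diff ^^ m) f (of_nat n + 1)"
  by (induction m arbitrary: n) (simp_all add: fwd_diff_def add_ac)

text \<open>Induction on \<open>m\<close>: the differences \<open>fwd_diff (f i)\<close> again form
  a chain of derivatives. The induction hypothesis turns all but one difference into derivatives,
  and the mean value theorem on \<open>[z, z + 1]\<close> handles the last.\<close>

lemma fwd_diff_pow_mean_value:
  fixes f :: "nat \<Rightarrow> real \<Rightarrow> real"
  assumes "\<And>i x. x > 0 \<Longrightarrow> (f i has_real_derivative f (Suc i) x) (at x)" and "x > 0"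
  shows "\<exists>z\<ge>x. (fwd_diff ^^ m) (f 0) x = f m z"
  using assms(1)
proof (induction m arbitrary: f)
  case 0
  then show ?case by auto
next
  case (Suc m)
  have "(fwd_diff (f i) has_real_derivative fwd_diff (f (Suc i)) y) (at y)" if "y > 0" for i y
    unfolding fwd_diff_def
    by (rule derivative_intros DERIV_shift[THEN iffD1] Suc.prems that | use that in simp)+
  then obtain z where z: "z \<ge> x" "(fwd_diff ^^ m) (fwd_diff (f 0)) x = fwd_diff (f m) z"
    using Suc.IH[of "\<lambda>i. fwd_diff (f i)"] by blast
  have "\<exists>w. z < w \<and> w < z + 1 \<and> f m (z + 1) - f m z = (z + 1 - z) * f (Suc m) w"
    using z(1) \<open>x > 0\<close> by (intro MVT2 Suc.prems) auto
  then show ?case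
    using z unfolding fwd_diff_pow_Suc fwd_diff_def[of "f m"] by (smt (verit) mult_cancel_right1)
qed

lemma powr_fwd_diff_mean_value:
  fixes c x :: real
  assumes "x > 0"
  shows "\<exists>z\<ge>x. (fwd_diff ^^ m) (\<lambda>x. x powr c) x = (\<Prod>i<m. c - real i) * z powr (c - real m)"
proof -
  \<comment> \<open>The \<open>i\<close>-th derivative of \<open>x powr c\<close>.\<close>
  define f where "f i x = (\<Prod>j<i. c - real j) * x powr (c - real i)" for i x
  have "(f i has_real_derivative f (Suc i) y) (at y)" if "y > 0" for i y
  proof -
    have "((\<lambda>x. (\<Prod>j<i. c - real j) * x powr (c - real i)) has_real_derivative
            (\<Prod>j<i. c - real j) * ((c - real i) * y powr (c - real i - 1))) (at y)"
      using that by (intro DERIV_cmult has_real_derivative_powr)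
    then show ?thesis
      unfolding f_def by (simp add: algebra_simps)
  qed
  from fwd_diff_pow_mean_value[of f, OF this assms, of m] show ?thesis
    by (simp add: f_def[of 0] f_def[of m] f_def[abs_def])
qed

lemma fwd_diff_sign_change:
  fixes u :: "nat \<Rightarrow> real"
  assumes "a < b" and "s * u a > 0" and "s * u b < 0"
  shows "\<exists>t\<in>{a..<b}. s * fwd_diff u t < 0"
proof (rule ccontr)
  assume "\<not> ?thesis"
  then have step: "s * u t \<le> s * u (Suc t)" if "a \<le> t" "t < b" for t
    using that by (force simp: fwd_diff_def algebra_simps)
  have "a + k \<le> b \<Longrightarrow> s * u a \<le> s * u (a + k)" for k
  proof (induction k)
    case (Suc k)
    then show ?case using step[of "a + k"] by simp
  qed simp
  from this[of "b - a"] show False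
    using assms by simp
qed

text \<open>Between two consecutive points of alternating sign \<open>fwd_diff u\<close> has a value
  of known sign, so \<open>m + 1\<close> alternations of \<open>u\<close> give \<open>m\<close>
  alternations of its difference. After \<open>m\<close> rounds a single value of known sign
  remains.\<close>

lemma discrete_Rolle:
  fixes u :: "nat \<Rightarrow> real"
  assumes "strict_mono_on {..m} h" and "\<And>i. i \<le> m \<Longrightarrow> s * (-1) ^ i * u (h i) > 0"
  shows "\<exists>t. s * (-1) ^ m * (fwd_diff ^^ m) u t > 0"
  using assms
proof (induction m arbitrary: u h s)
  case 0
  then show ?case by auto
next
  case (Suc m)
  have "\<exists>t\<in>{h i..<h (Suc i)}. (s * (-1) ^ i) * fwd_diff u t < 0" if "i \<le> m" for i
  proof (rule fwd_diff_sign_change)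
    show "h i < h (Suc i)"
      using Suc.prems(1) that by (auto simp: strict_mono_on_def)
    show "s * (-1) ^ i * u (h i) > 0" "s * (-1) ^ i * u (h (Suc i)) < 0"
      using Suc.prems(2)[of i] Suc.prems(2)[of "Suc i"] that by auto
  qed
  then obtain t where t: "\<And>i. i \<le> m \<Longrightarrow> h i \<le> t i \<and> t i < h (Suc i) \<and> s * (-1) ^ i * fwd_diff u (t i) < 0"
    by (metis atLeastLessThan_iff)
  \<comment> \<open>The half-open intervals from \<open>h i\<close> to \<open>h (Suc i)\<close> are
    disjoint and ordered.\<close>
  have "strict_mono_on {..m} t"
  proof (rule strict_mono_onI)
    fix i j assume ij: "i \<in> {..m}" "j \<in> {..m}" "i < j"
    then have "h (Suc i) \<le> h j"
      using strict_mono_on_leD[OF Suc.prems(1), of "Suc i" j] by simp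
    then show "t i < t j"
      using t[of i] t[of j] ij by auto
  qed
  moreover have "(-s) * (-1) ^ i * fwd_diff u (t i) > 0" if "i \<le> m" for i
    using t[OF that] by simp
  ultimately have "\<exists>y. (-s) * (-1) ^ m * (fwd_diff ^^ m) (fwd_diff u) y > 0"
    by (rule Suc.IH)
  then show ?case
    unfolding fwd_diff_pow_Suc by simp
qed

text \<open>Repeated summation starting from the \<open>m\<close>-th difference: at each level the
  constant of summation is reduced modulo \<open>q\<close>, which changes the function only by
  integer multiples of \<open>q\<close>. Each summation costs one factor \<open>1 + h\<close> in the
  bound.\<close>

lemma reduce_mod_fwd_diff_kernel:
  fixes u :: "nat \<Rightarrow> real"
  assumes "\<And>h. \<bar>(fwd_diff ^^ m) u h\<bar> \<le> C" and "0 < q" and "q \<le> C"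
  shows "\<exists>g. (fwd_diff ^^ m) g = (fwd_diff ^^ m) u \<and> (\<forall>h. \<exists>k::int. u h = g h + q * k) \<and>
    (\<forall>h. \<bar>g h\<bar> \<le> C * (1 + real h) ^ m)"
  using assms(1)
proof (induction m arbitrary: u)
  case 0
  show ?case
    by (intro exI[of _ u]) (use 0 in \<open>auto intro!: exI[of _ "0::int"]\<close>)
next
  case (Suc m)
  obtain g' where g': "(fwd_diff ^^ m) g' = (fwd_diff ^^ m) (fwd_diff u)"
    "\<And>h. \<exists>k::int. fwd_diff u h = g' h + q * k" "\<And>h. \<bar>g' h\<bar> \<le> C * (1 + real h) ^ m"
    using Suc.IH[of "fwd_diff u"] Suc.prems unfolding fwd_diff_pow_Suc by metis
  \<comment> \<open>The constant of summation, reduced to the interval from 0 to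
    \<open>q\<close>.\<close>
  define r where "r = u 0 - q * \<lfloor>u 0 / q\<rfloor>"
  have r: "\<bar>r\<bar> \<le> C"
  proof -
    have "r = q * frac (u 0 / q)"
      using assms(2) by (simp add: r_def frac_def algebra_simps)
    moreover have "\<dots> \<le> q * 1" "\<dots> \<ge> 0"
      using assms(2) frac_lt_1[of "u 0 / q"] by (auto intro!: mult_left_mono)
    ultimately show ?thesis using assms(3) by linarith
  qed
  define g where "g h = r + (\<Sum>i<h. g' i)" for h
  have "fwd_diff g = g'"
    by (rule ext) (simp add: fwd_diff_def g_def)
  moreover have "\<exists>k::int. u h = g h + q * k" for h
  proof (induction h)
    case 0
    show ?case by (intro exI[of _ "\<lfloor>u 0 / q\<rfloor>"]) (simp add: g_def r_def)
  next
    case (Suc h)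
    then obtain k k' :: int where "u h = g h + q * k" "fwd_diff u h = g' h + q * k'"
      using g'(2) by blast
    then show ?case
      by (intro exI[of _ "k + k'"]) (simp add: g_def fwd_diff_def algebra_simps)
  qed
  moreover have "\<bar>g h\<bar> \<le> C * (1 + real h) ^ Suc m" for h
  proof -
    have "\<bar>\<Sum>i<h. g' i\<bar> \<le> (\<Sum>i<h. C * (1 + real h) ^ m)"
      using assms g'(3)
      by (intro order.trans[OF sum_abs] sum_mono order.trans[OF g'(3)] mult_left_mono power_mono) auto
    moreover have "C * 1 \<le> C * (1 + real h) ^ m"
      using assms by (intro mult_left_mono one_le_power) auto
    ultimately show ?thesis
      using r by (simp add: g_def algebra_simps)
  qed
  ultimately show ?case
    using g'(1) by (intro exI[of _ g]) (simp only: fwd_diff_pow_Suc, blast)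
qed

section \<open>The Sauer-Shelah lemma\<close>

definition shatters :: "'a set set \<Rightarrow> 'a set \<Rightarrow> bool" where
  "shatters F Y \<longleftrightarrow> (\<forall>A\<subseteq>Y. \<exists>S\<in>F. S \<inter> Y = A)"

text \<open>Pajor's form of the Sauer-Shelah lemma. \<open>F\<close> is split into the members
  omitting \<open>x\<close> and those containing \<open>x\<close>, the latter with \<open>x\<close>
  removed. A set \<open>Y\<close> shattered by both parts counts twice, as \<open>Y\<close> and as
  \<open>insert x Y\<close>.\<close>

lemma card_le_card_shattered:
  assumes "finite X" and "F \<subseteq> Pow X"
  shows "card F \<le> card {Y. Y \<subseteq> X \<and> shatters F Y}"
  using assms
proof (induction X arbitrary: F rule: finite_induct)
  case empty
  show ?case
  proof (cases "F = {}")
    case False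
    then have "{Y. Y \<subseteq> {} \<and> shatters F Y} = {{}}"
      by (auto simp: shatters_def)
    then show ?thesis
      using card_mono[OF _ empty.prems] by simp
  qed simp
next
  case (insert x X)
  define sh where "sh G = {Y. Y \<subseteq> X \<and> shatters G Y}" for G
  define F0 where "F0 = {A \<in> F. x \<notin> A}"
  define F1 where "F1 = (\<lambda>A. A - {x}) ` {A \<in> F. x \<in> A}"
  have fin: "finite F"
    using insert.prems insert.hyps by (meson finite.insertI finite_Pow_iff finite_subset)
  have finsh: "finite (sh G)" for G
    using insert.hyps by (simp add: sh_def)
  have "card F1 = card {A \<in> F. x \<in> A}"
    unfolding F1_def by (rule card_image) (auto simp: inj_on_def)
  moreover have "card F = card F0 + card {A \<in> F. x \<in> A}"
    unfolding F0_def using fin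
    by (subst card_Un_disjoint[symmetric]) (auto intro!: arg_cong[where f = card])
  ultimately have "card F = card F0 + card F1" by simp
  also have "\<dots> \<le> card (sh F0) + card (sh F1)"
    unfolding sh_def using insert.prems
    by (intro add_mono insert.IH) (auto simp: F0_def F1_def)
  also have "\<dots> = card (sh F0 \<union> sh F1) + card (sh F0 \<inter> sh F1)"
    using finsh by (intro card_Un_Int)
  also have "card (sh F0 \<inter> sh F1) = card (insert x ` (sh F0 \<inter> sh F1))"
    using insert.hyps by (intro card_image[symmetric]) (auto simp: inj_on_def sh_def)
  \<comment> \<open>Disjoint because the sets in \<open>sh G\<close> lie in \<open>X\<close> and so
    do not contain \<open>x\<close>.\<close>
  also have "card (sh F0 \<union> sh F1) + \<dots> = card (sh F0 \<union> sh F1 \<union> insert x ` (sh F0 \<inter> sh F1))"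
    using finsh insert.hyps by (intro card_Un_disjoint[symmetric]) (auto simp: sh_def)
  also have "\<dots> \<le> card {Y. Y \<subseteq> insert x X \<and> shatters F Y}"
  proof (rule card_mono)
    show "finite {Y. Y \<subseteq> insert x X \<and> shatters F Y}"
      using insert.hyps by simp
    have "shatters F Y" if "Y \<in> sh F0" for Y
      using that unfolding sh_def shatters_def F0_def by blast
    moreover have "shatters F Y" if Y: "Y \<in> sh F1" for Y
      unfolding shatters_def
    proof safe
      fix A assume "A \<subseteq> Y"
      then obtain S where "S \<in> F1" "S \<inter> Y = A"
        using Y unfolding sh_def shatters_def by blast
      then obtain S where "S \<in> F" "(S - {x}) \<inter> Y = A"
        unfolding F1_def by blast
      then show "\<exists>S\<in>F. S \<inter> Y = A"
        using Y insert.hyps unfolding sh_def by blast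
    qed
    moreover have "shatters F (insert x Y)" if Y: "Y \<in> sh F0" "Y \<in> sh F1" for Y
      unfolding shatters_def
    proof safe
      fix A assume A: "A \<subseteq> insert x Y"
      show "\<exists>S\<in>F. S \<inter> insert x Y = A"
      proof (cases "x \<in> A")
        case True
        have "A - {x} \<subseteq> Y" using A by blast
        then obtain S where "S \<in> F1" "S \<inter> Y = A - {x}"
          using Y(2) unfolding sh_def shatters_def by blast
        then obtain S where "S \<in> F" "x \<in> S" "(S - {x}) \<inter> Y = A - {x}"
          unfolding F1_def by blast
        then show ?thesis using True by blast
      next
        case False
        then have "A \<subseteq> Y" using A by blast
        then obtain S where "S \<in> F" "x \<notin> S" "S \<inter> Y = A"
          using Y(1) unfolding sh_def shatters_def F0_def by blast
        then show ?thesis using False by blast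
      qed
    qed
    ultimately show "sh F0 \<union> sh F1 \<union> insert x ` (sh F0 \<inter> sh F1)
        \<subseteq> {Y. Y \<subseteq> insert x X \<and> shatters F Y}"
      by (auto simp: sh_def)
  qed
  finally show ?case .
qed

lemma card_subsets_card_le:
  assumes "finite X"
  shows "card {Y. Y \<subseteq> X \<and> card Y \<le> d} \<le> (card X + 1) ^ d"
proof (induction d)
  case 0
  have "{Y. Y \<subseteq> X \<and> card Y \<le> 0} \<subseteq> {{}}"
    using assms by (auto dest: finite_subset)
  then have "card {Y. Y \<subseteq> X \<and> card Y \<le> 0} \<le> card {{} :: 'a set}"
    by (intro card_mono) auto
  then show ?case by simp
next
  case (Suc d)
  let ?S = "\<lambda>d. {Y. Y \<subseteq> X \<and> card Y \<le> d}"
  have fin: "finite (?S d)" using assms by simp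
  have "?S (Suc d) \<subseteq> ?S d \<union> (\<lambda>(x, Y). insert x Y) ` (X \<times> ?S d)"
  proof
    fix Y assume Y: "Y \<in> ?S (Suc d)"
    show "Y \<in> ?S d \<union> (\<lambda>(x, Y). insert x Y) ` (X \<times> ?S d)"
    proof (cases "card Y \<le> d")
      case False
      then obtain x where x: "x \<in> Y" by fastforce
      then have "(x, Y - {x}) \<in> X \<times> ?S d" "Y = insert x (Y - {x})"
        using Y assms by (auto dest: finite_subset)
      then show ?thesis by (intro UnI2 image_eqI[of _ _ "(x, Y - {x})"]) auto
    qed (use Y in auto)
  qed
  then have "card (?S (Suc d)) \<le> card (?S d \<union> (\<lambda>(x, Y). insert x Y) ` (X \<times> ?S d))"
    using fin assms by (intro card_mono finite_UnI finite_imageI finite_cartesian_product)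
  also have "\<dots> \<le> card (?S d) + card (X \<times> ?S d)"
    using fin assms
    by (intro order.trans[OF card_Un_le] add_left_mono card_image_le finite_cartesian_product)
  also have "\<dots> = (card X + 1) * card (?S d)"
    by (simp add: card_cartesian_product)
  also have "\<dots> \<le> (card X + 1) ^ Suc d"
    unfolding power_Suc using Suc.IH by (intro mult_left_mono) auto
  finally show ?case .
qed

text \<open>The crude power bound replaces the usual sum of binomial coefficients; for fixed
  \<open>d\<close> it is still polynomial in \<open>card X\<close>.\<close>

lemma Sauer_Shelah:
  assumes "finite X" and "F \<subseteq> Pow X" and "\<And>Y. Y \<subseteq> X \<Longrightarrow> shatters F Y \<Longrightarrow> card Y \<le> d"
  shows "card F \<le> (card X + 1) ^ d"
proof -
  have "card F \<le> card {Y. Y \<subseteq> X \<and> shatters F Y}"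
    using assms by (intro card_le_card_shattered)
  also have "\<dots> \<le> card {Y. Y \<subseteq> X \<and> card Y \<le> d}"
    using assms by (intro card_mono) auto
  also have "\<dots> \<le> (card X + 1) ^ d"
    using assms by (intro card_subsets_card_le)
  finally show ?thesis .
qed

section \<open>Subgraphs of sequences with comparable differences\<close>

lemma card_shattered_by_subgraphs:
  fixes g :: "'i \<Rightarrow> nat \<Rightarrow> real"
  assumes comparable: "\<And>n n'. (\<forall>t. (fwd_diff ^^ m) (g n) t \<le> (fwd_diff ^^ m) (g n') t) \<or>
      (\<forall>t. (fwd_diff ^^ m) (g n') t \<le> (fwd_diff ^^ m) (g n) t)"
    and "finite Y" and "Y \<subseteq> X"
    and sh: "shatters (range (\<lambda>n. {(h, j::int). (h, j) \<in> X \<and> j \<le> g n h})) Y"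
  shows "card Y \<le> 2 * m + 1"
proof (rule ccontr)
  assume "\<not> card Y \<le> 2 * m + 1"
  have pattern: "\<exists>n. \<forall>(h, j)\<in>Y. (h, j) \<in> A \<longleftrightarrow> j \<le> g n h" if A: "A \<subseteq> Y" for A
  proof -
    obtain n where "{(h, j::int). (h, j) \<in> X \<and> j \<le> g n h} \<inter> Y = A"
      using sh A unfolding shatters_def by blast
    then show ?thesis
      using \<open>Y \<subseteq> X\<close> by (intro exI[of _ n]) blast
  qed
  \<comment> \<open>Of two points in the same column, the upper one cannot be cut out alone by a
    subgraph.\<close>
  have inj: "inj_on fst Y"
  proof (rule inj_onI)
    fix y y' assume y: "y \<in> Y" "y' \<in> Y" "fst y = fst y'"
    have less: "\<not> j < j'" if jj: "(h, j) \<in> Y" "(h, j') \<in> Y" for h and j j' :: int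
    proof
      assume "j < j'"
      obtain n where n: "\<forall>(i, k)\<in>Y. (i, k) \<in> {(h, j')} \<longleftrightarrow> k \<le> g n i"
        using pattern[of "{(h, j')}"] jj by blast
      then have "j' \<le> g n h" "\<not> j \<le> g n h"
        using jj \<open>j < j'\<close> by auto
      then show False
        using \<open>j < j'\<close> by linarith
    qed
    show "y = y'"
      using less[of "fst y" "snd y" "snd y'"] less[of "fst y" "snd y'" "snd y"] y
      by (metis linorder_neqE prod.collapse)
  qed
  define e where "e i = sorted_list_of_set (fst ` Y) ! i" for i
  have len: "length (sorted_list_of_set (fst ` Y)) = card Y"
    using inj by (simp add: card_image)
  have e_in: "e i \<in> fst ` Y" if "i < card Y" for i
    using nth_mem[of i "sorted_list_of_set (fst ` Y)"] that \<open>finite Y\<close> len by (simp add: e_def)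
  have e_mono: "e i < e i'" if "i < i'" "i' < card Y" for i i'
    using sorted_wrt_nth_less[OF strict_sorted_list_of_set[of "fst ` Y"], of i i'] that len
    by (simp add: e_def)
  have "\<exists>j. (e i, j) \<in> Y" if "i < card Y" for i
    using e_in[OF that] by force
  then obtain j where j: "\<And>i. i < card Y \<Longrightarrow> (e i, j i) \<in> Y"
    by metis
  \<comment> \<open>Signs alternate on the first \<open>m + 1\<close> positions starting with plus,
    and on the next \<open>m + 1\<close> starting with minus.\<close>
  define pos where "pos i \<longleftrightarrow> (if i \<le> m then even i else odd (i - Suc m))" for i
  define A where "A = {(e i, j i) | i. i < card Y \<and> pos i}"
  have A: "A \<subseteq> Y"
    using j by (auto simp: A_def)
  have A_iff: "(e i, j i) \<in> A \<longleftrightarrow> pos i" if i: "i < card Y" for i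
  proof
    assume "(e i, j i) \<in> A"
    then obtain k where k: "k < card Y" "pos k" "e i = e k"
      by (auto simp: A_def)
    then have "i = k"
      using i e_mono[of i k] e_mono[of k i] by (metis less_irrefl linorder_neqE_nat)
    then show "pos i" using k by simp
  qed (use i in \<open>auto simp: A_def\<close>)
  obtain n where n: "\<forall>(h, j)\<in>Y. (h, j) \<in> A \<longleftrightarrow> j \<le> g n h"
    using pattern[OF A] by blast
  \<comment> \<open>Using the complement of \<open>A\<close> puts each point of \<open>Y\<close>
    under exactly one of the two graphs, so every sign of \<open>u\<close> on the columns is
    strict.\<close>
  obtain n' where n': "\<forall>(h, j)\<in>Y. (h, j) \<in> Y - A \<longleftrightarrow> j \<le> g n' h"
    using pattern[of "Y - A"] by blast
  define u where "u h = g n h - g n' h" for h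
  have u_sign: "if pos i then u (e i) > 0 else u (e i) < 0" if i: "i < card Y" for i
    using n n' j[OF i] A_iff[OF i] by (fastforce simp: u_def split: if_splits)
  have Du: "(fwd_diff ^^ m) u t = (fwd_diff ^^ m) (g n) t - (fwd_diff ^^ m) (g n') t" for t
    unfolding u_def by (rule fwd_diff_pow_diff)
  have "\<exists>t. 1 * (-1) ^ m * (fwd_diff ^^ m) u t > 0"
  proof (rule discrete_Rolle)
    show "strict_mono_on {..m} e"
      using \<open>\<not> card Y \<le> 2 * m + 1\<close> by (intro strict_mono_onI e_mono) auto
    show "1 * (-1) ^ i * u (e i) > 0" if i: "i \<le> m" for i
      using u_sign[of i] i \<open>\<not> card Y \<le> 2 * m + 1\<close> by (auto simp: pos_def split: if_splits)
  qed
  moreover have "\<exists>t. (-1) * (-1) ^ m * (fwd_diff ^^ m) u t > 0"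
  proof (rule discrete_Rolle)
    show "strict_mono_on {..m} (\<lambda>i. e (Suc m + i))"
      using \<open>\<not> card Y \<le> 2 * m + 1\<close> by (intro strict_mono_onI e_mono) auto
    show "(-1) * (-1) ^ i * u (e (Suc m + i)) > 0" if i: "i \<le> m" for i
      using u_sign[of "Suc m + i"] i \<open>\<not> card Y \<le> 2 * m + 1\<close> by (auto simp: pos_def split: if_splits)
  qed
  ultimately show False
    using comparable[of n n'] unfolding Du
    by (cases "even m") (auto simp: not_less[symmetric])
qed

section \<open>Complexity of periodic functions of integer parts\<close>

text \<open>In the application \<open>z\<close> is the floor of \<open>g n h\<close>, which may be
  negative; hence the congruence over the integers.\<close>

lemma periodic_eq_if_cong:
  fixes x y :: int
  assumes "\<And>n. a (n + q) = a n" and "0 \<le> x" and "0 \<le> y" and "x = z + int q * k" and "y = z + int q * l"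
  shows "a (nat x) = a (nat y)"
proof -
  have add: "a (n + q * i) = a n" for n i
  proof (induction i)
    case (Suc i)
    then show ?case using assms(1)[of "n + q * i"] by (simp add: algebra_simps)
  qed simp
  have le: "a (nat x) = a (nat y)"
    if xy: "0 \<le> x" "0 \<le> y" "x = z + int q * k" "y = z + int q * l" "k \<le> l" for x y k l
  proof -
    have "y = x + int q * int (nat (l - k))"
      using xy by (simp add: algebra_simps)
    then have "nat y = nat x + q * nat (l - k)"
      using xy by (metis nat_add_distrib nat_int of_nat_0_le_iff of_nat_mult)
    then show ?thesis by (simp add: add)
  qed
  show ?thesis
    using le[OF assms(2-5)] le[OF assms(3,2,5,4)] by (metis linear)
qed

lemma card_range_factor_le:
  assumes "finite (range S)" and "\<And>n n'. S n = S n' \<Longrightarrow> w n = w n'"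
  shows "card (range w) \<le> card (range S)"
proof -
  have "w n = w (inv S (S n))" for n
    by (rule assms(2)) (simp add: f_inv_into_f)
  then have "range w \<subseteq> (w \<circ> inv S) ` range S"
    by auto
  then show ?thesis
    using assms(1) by (rule surj_card_le[rotated])
qed

text \<open>The word at \<open>n\<close> depends only on \<open>S n\<close>, the part of the
  subgraph of \<open>g n\<close> in a box \<open>X\<close> of polynomial size. Since these sets
  shatter at most \<open>2 * m + 1\<close> points, their number is polynomial in
  \<open>H\<close>.\<close>

lemma floor_seq_complexity_le_poly:
  fixes f :: "nat \<Rightarrow> real"
  assumes "q > 0" and period: "\<And>n. a (n + q) = a n" and "\<And>n. f n \<ge> 0"
    and bounded: "\<And>n. \<bar>(fwd_diff ^^ m) f n\<bar> \<le> C"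
    and mono: "mono ((fwd_diff ^^ m) f) \<or> antimono ((fwd_diff ^^ m) f)"
  shows "\<exists>P :: real poly. \<forall>H. real (subword_complexity (\<lambda>n. a (nat \<lfloor>f n\<rfloor>)) H) \<le> poly P (real H)"
proof -
  \<comment> \<open>Reduction modulo \<open>q\<close> needs a bound that is at least
    \<open>q\<close>; taking it in \<open>nat\<close> makes the box height \<open>M\<close> an
    integer.\<close>
  define B where "B = max q (nat \<lceil>C\<rceil>)"
  have B: "real q \<le> real B" "C \<le> real B"
    by (auto simp: B_def le_max_iff_disj) linarith
  have "\<forall>n. \<exists>g. (fwd_diff ^^ m) g = (fwd_diff ^^ m) (\<lambda>h. f (n + h)) \<and>
      (\<forall>h. \<exists>k::int. f (n + h) = g h + real q * k) \<and> (\<forall>h. \<bar>g h\<bar> \<le> real B * (1 + real h) ^ m)"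
    using assms B
    by (intro allI reduce_mod_fwd_diff_kernel)
       (auto simp: fwd_diff_pow_shift intro: order.trans[OF bounded])
  then obtain g where
      diff_g: "\<And>n. (fwd_diff ^^ m) (g n) = (fwd_diff ^^ m) (\<lambda>h. f (n + h))"
    and g_cong: "\<And>n h. \<exists>k::int. f (n + h) = g n h + real q * k"
    and g_le: "\<And>n h. \<bar>g n h\<bar> \<le> real B * (1 + real h) ^ m"
    by metis
  have comparable: "(\<forall>t. (fwd_diff ^^ m) (g n) t \<le> (fwd_diff ^^ m) (g n') t) \<or>
      (\<forall>t. (fwd_diff ^^ m) (g n') t \<le> (fwd_diff ^^ m) (g n) t)" for n n'
    unfolding diff_g fwd_diff_pow_shift using mono
    by (metis add_le_mono1 antimonoD monoD nle_le)
  \<comment> \<open>This is \<open>(card X + 1) ^ (2 * m + 1)\<close> as a polynomial in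
    \<open>H\<close>: the box has \<open>H\<close> columns of \<open>2 * M + 1\<close> points
    each.\<close>
  define P :: "real poly" where
    "P = ([:0, 1:] * (2 * [:real B:] * [:1, 1:] ^ m + 1) + 1) ^ (2 * m + 1)"
  have "real (subword_complexity (\<lambda>n. a (nat \<lfloor>f n\<rfloor>)) H) \<le> poly P (real H)" for H
  proof -
    define M where "M = int (B * (1 + H) ^ m)"
    define X where "X = {..<H} \<times> {-M..M}"
    define S where "S n = {(h, j). (h, j) \<in> X \<and> j \<le> g n h}" for n
    define w where "w n = map (\<lambda>n. a (nat \<lfloor>f n\<rfloor>)) [n..<n + H]" for n
    have "finite X" by (simp add: X_def)
    have "range S \<subseteq> Pow X" by (auto simp: S_def)
    then have "finite (range S)"
      using \<open>finite X\<close> by (meson finite_Pow_iff finite_subset)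
    \<comment> \<open>The top point of column \<open>h\<close> in \<open>S n\<close> has height
      equal to the floor of \<open>g n h\<close>, as the box is tall enough to contain it. Equal
      sets thus have equal floors, by symmetry.\<close>
    have floor_le: "\<lfloor>g n h\<rfloor> \<le> \<lfloor>g n' h\<rfloor>" if "S n = S n'" "h < H" for n n' h
    proof -
      have "real B * (1 + real h) ^ m \<le> real B * (1 + real H) ^ m"
        using that by (intro mult_left_mono power_mono) auto
      then have "\<bar>g n h\<bar> \<le> real_of_int M"
        using g_le[of n h] by (simp add: M_def)
      then have "\<lfloor>g n h\<rfloor> \<in> {-M..M}"
        by (auto simp: le_floor_iff floor_le_iff)
      then have "(h, \<lfloor>g n h\<rfloor>) \<in> S n"
        using that(2) by (simp add: S_def X_def)
      then have "(h, \<lfloor>g n h\<rfloor>) \<in> S n'"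
        by (simp only: that(1))
      then show ?thesis
        by (simp add: S_def le_floor_iff)
    qed
    have "w n = w n'" if "S n = S n'" for n n'
    proof (rule nth_equalityI)
      fix h assume "h < length (w n)"
      then have h: "h < H" by (simp add: w_def)
      obtain k k' :: int where "f (n + h) = g n h + real q * k" "f (n' + h) = g n' h + real q * k'"
        using g_cong by metis
      then have "f (n + h) = g n h + of_int (int q * k)" "f (n' + h) = g n' h + of_int (int q * k')"
        by simp_all
      then have "\<lfloor>f (n + h)\<rfloor> = \<lfloor>g n h\<rfloor> + int q * k" "\<lfloor>f (n' + h)\<rfloor> = \<lfloor>g n' h\<rfloor> + int q * k'"
        by (simp_all only: floor_add_int)
      moreover have "0 \<le> \<lfloor>f (n + h)\<rfloor>" "0 \<le> \<lfloor>f (n' + h)\<rfloor>"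
        using assms(3) by simp_all
      moreover have "\<lfloor>g n h\<rfloor> = \<lfloor>g n' h\<rfloor>"
        using floor_le[of n n' h] floor_le[of n' n h] that h by simp
      ultimately have "a (nat \<lfloor>f (n + h)\<rfloor>) = a (nat \<lfloor>f (n' + h)\<rfloor>)"
        by (metis periodic_eq_if_cong[where a = a, OF period])
      then show "w n ! h = w n' ! h"
        using h by (simp add: w_def)
    qed (simp add: w_def)
    then have "card (range w) \<le> card (range S)"
      by (intro card_range_factor_le \<open>finite (range S)\<close>)
    also have "\<dots> \<le> (card X + 1) ^ (2 * m + 1)"
      using \<open>finite X\<close> \<open>range S \<subseteq> Pow X\<close>
    proof (rule Sauer_Shelah)
      fix Y assume "Y \<subseteq> X" "shatters (range S) Y"
      then show "card Y \<le> 2 * m + 1"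
        using \<open>finite X\<close> unfolding S_def
        by (intro card_shattered_by_subgraphs[OF comparable]) (auto intro: finite_subset)
    qed
    finally have "real (card (range w)) \<le> real ((card X + 1) ^ (2 * m + 1))"
      by (simp only: of_nat_le_iff)
    also have "\<dots> = poly P (real H)"
      by (simp add: P_def X_def M_def card_cartesian_product algebra_simps nat_add_distrib nat_mult_distrib nat_power_eq)
    also have "range w = subwords (\<lambda>n. a (nat \<lfloor>f n\<rfloor>)) H"
      by (auto simp: subwords_def w_def)
    finally show ?thesis
      by (simp add: subword_complexity_def)
  qed
  then show ?thesis by blast
qed

text \<open>Only the word starting at 0 can be missing from the tail. Dropping the first term keeps
  the argument of \<open>powr\<close> positive, as the derivative argument requires.\<close>

lemma subword_complexity_le_Suc_tail:
  assumes "finite (range b)"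
  shows "subword_complexity b H \<le> Suc (subword_complexity (\<lambda>n. b (Suc n)) H)"
proof -
  have "subwords b H \<subseteq> insert (map b [0..<H]) (subwords (\<lambda>n. b (Suc n)) H)"
  proof
    fix xs assume "xs \<in> subwords b H"
    then obtain n where n: "xs = map b [n..<n + H]"
      by (auto simp: subwords_def)
    show "xs \<in> insert (map b [0..<H]) (subwords (\<lambda>n. b (Suc n)) H)"
    proof (cases n)
      case (Suc k)
      have "xs = map (\<lambda>n. b (Suc n)) [k..<k + H]"
        unfolding n Suc by (rule nth_equalityI) (auto simp del: upt_Suc)
      then show ?thesis by (auto simp: subwords_def)
    qed (use n in simp)
  qed
  moreover have "finite (subwords (\<lambda>n. b (Suc n)) H)"
    using assms by (intro finite_subwords) (auto elim: finite_subset[rotated])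
  ultimately have "subword_complexity b H \<le>
      card (insert (map b [0..<H]) (subwords (\<lambda>n. b (Suc n)) H))"
    unfolding subword_complexity_def by (intro card_mono) auto
  also have "\<dots> \<le> Suc (subword_complexity (\<lambda>n. b (Suc n)) H)"
    by (simp add: subword_complexity_def card_insert_le_m1)
  finally show ?thesis .
qed

text \<open>By the mean value formula the \<open>m\<close>-th difference is a fixed product times a
  power of some \<open>z \<ge> 1\<close> with exponent at most 0, hence bounded. The next difference
  has the constant sign of its own product, which gives monotonicity.\<close>

lemma powr_fwd_diff_bounded_monotone:
  fixes c :: real
  assumes "c \<le> real m"
  defines "f \<equiv> \<lambda>n::nat. (real n + 1) powr c"
  shows "\<bar>(fwd_diff ^^ m) f n\<bar> \<le> \<bar>\<Prod>i<m. c - real i\<bar>"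
    and "mono ((fwd_diff ^^ m) f) \<or> antimono ((fwd_diff ^^ m) f)"
proof -
  have mv: "\<exists>z\<ge>1. (fwd_diff ^^ k) f n = (\<Prod>i<k. c - real i) * z powr (c - real k)" for k n
  proof -
    obtain z where "z \<ge> real n + 1" "(fwd_diff ^^ k) (\<lambda>x. x powr c) (real n + 1) =
        (\<Prod>i<k. c - real i) * z powr (c - real k)"
      using powr_fwd_diff_mean_value[of "real n + 1" k c] by auto
    then show ?thesis
      unfolding f_def fwd_diff_pow_of_nat[of _ "\<lambda>x. x powr c"] by (intro exI[of _ z]) auto
  qed
  obtain z where z: "z \<ge> 1" "(fwd_diff ^^ m) f n = (\<Prod>i<m. c - real i) * z powr (c - real m)"
    using mv by blast
  have "z powr (c - real m) \<le> z powr 0"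
    using z assms by (intro powr_mono) auto
  then show "\<bar>(fwd_diff ^^ m) f n\<bar> \<le> \<bar>\<Prod>i<m. c - real i\<bar>"
    using z by (auto simp: abs_mult intro!: mult_left_le)
  have step: "(fwd_diff ^^ m) f (Suc n) = (fwd_diff ^^ m) f n + (fwd_diff ^^ Suc m) f n" for n
    by (simp add: fwd_diff_def)
  show "mono ((fwd_diff ^^ m) f) \<or> antimono ((fwd_diff ^^ m) f)"
  proof (cases "(\<Prod>i<Suc m. c - real i) \<ge> 0")
    case True
    then have "(fwd_diff ^^ Suc m) f n \<ge> 0" for n
      using mv[of "Suc m" n] by (metis mult_nonneg_nonneg powr_ge_zero)
    then show ?thesis
      unfolding mono_iff_le_Suc step by simp
  next
    case False
    then have "(fwd_diff ^^ Suc m) f n \<le> 0" for n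
      using mv[of "Suc m" n] by (metis mult_nonpos_nonneg nle_le powr_ge_zero)
    then show ?thesis
      unfolding antimono_iff_le_Suc step by simp
  qed
qed

theorem theorem1p3:
  fixes a :: "nat \<Rightarrow> 'a" and c :: real
  assumes "periodic_seq a"
    and "finite (range a)"
    and "c > 1"
    and "c \<notin> \<int>"
  shows "\<exists>P :: real poly. \<forall>H :: nat.
    real (subword_complexity (\<lambda>n. a (nat \<lfloor>real n powr c\<rfloor>)) H) \<le> poly P (real H)"
proof -
  let ?b = "\<lambda>n. a (nat \<lfloor>real n powr c\<rfloor>)"
  obtain q where q: "q > 0" "\<And>n. a (n + q) = a n"
    using assms(1) by (auto simp: periodic_seq_def)
  have m: "c \<le> real (nat \<lceil>c\<rceil>)"
    by linarith
  obtain P :: "real poly" where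
    P: "\<And>H. real (subword_complexity (\<lambda>n. a (nat \<lfloor>(real n + 1) powr c\<rfloor>)) H) \<le> poly P (real H)"
    using floor_seq_complexity_le_poly[of q a "\<lambda>n. (real n + 1) powr c",
        OF q _ powr_fwd_diff_bounded_monotone[OF m]] by auto
  have "finite (range ?b)"
    using assms(2) by (auto elim: finite_subset[rotated])
  then have "subword_complexity ?b H \<le> Suc (subword_complexity (\<lambda>n. ?b (Suc n)) H)" for H
    by (rule subword_complexity_le_Suc_tail)
  \<comment> \<open>The summand 1 accounts for the word starting at 0.\<close>
  then have "real (subword_complexity ?b H) \<le> poly (P + 1) (real H)" for H
    using P[of H] by (simp add: add.commute) (smt (verit) of_nat_Suc of_nat_le_iff)
  then show ?thesis by blast
qed

end
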